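(* Let $\psi:\mathbb{S}\to\mathbb{R}$ be twice continuously differentiable with exactly $N$ critical points $c_1,\dots,c_N$, $0<N<\infty$, all nondegenerate ($\psi''(c_i)\neq 0$). For $L>0$, $a\in[0,1)$ let $\tau_a(x)=a+x+L\psi(x)\pmod 1$, and for $\varepsilon>0$ consider the random map $\tau_a+Y$ with $Y$ uniformly distributed on $[-\varepsilon,\varepsilon]$. There exist a constant $D>0$ and $L_0>0$ such that for every $L\ge L_0$ and every $\varepsilon$ with $0<\varepsilon\le D L^{-1}$ there exist a parameter value $a\in[0,1)$ and an invariant measure $\mu$ for the random map $\tau_a+Y$ such that $$\lambda_a\bigl((\omega_n)_{n=1}^\infty,x;L\bigr)<0$$ for $(\eta^{\mathbb{Z}_+}\times\mu)$-a.e. $((\omega_n)_{n=1}^\infty,x)$.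
   Context: $\mathbb{S}$ is the circle obtained by identifying the endpoints of $[0,1]$. The map $\tau_a$ depends on $L$, although this is not indicated in the notation; $\tau_a'(x)=1+L\psi'(x)$. Random map: $x\mapsto \tau_a(x)+Y \pmod 1$, with independent copies of $Y$ at each time step. For $\omega\in\mathbb{R}$ write $\tau_a^\omega(x)=\tau_a(x)+\omega \pmod 1$, and let $\eta$ be the uniform probability measure on $[-\varepsilon,\varepsilon]$; $\eta^{\mathbb{Z}_+}$ is the product measure on sequences $(\omega_n)_{n=1}^\infty\in[-\varepsilon,\varepsilon]^{\mathbb{Z}_+}$. A Borel probability measure $\mu$ on $\mathbb{S}$ is invariant for $\tau_a+Y$ if $\mu(B)=\int_{[-\varepsilon,\varepsilon]}\mu((\tau_a^\omega)^{-1}B)\,d\eta(\omega)$ for every Borel set $B\subset\mathbb{S}$. Lyapunov exponent: given $(\omega_n)_{n\ge1}$ and $x$, set $x_0=x$ and $x_n=\tau_a(x_{n-1})+\omega_n \pmod 1$. Then $\lambda_a((\omega_n)_{n=1}^\infty,x;L)=\lim_{n\to\infty}\frac1n\sum_{k=0}^{n-1}\log|\tau_a'(x_k)|$, which exists $(\eta^{\mathbb{Z}_+}\times\mu)$-a.s. (as a value in $[-\infty,\infty)$) if $\mu$ is invariant. *)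

theory Defs
  imports "HOL-Probability.Probability"
begin

text \<open>
  The circle is represented by the fundamental domain \<open>{0..<1}\<close>, with \<open>frac\<close> as the quotient map
  from the reals, and a function on the circle by its 1-periodic lift to the reals. Derivatives
  on the circle are derivatives of the lift.
\<close>

definition circle_borel :: "real measure" where
  "circle_borel = restrict_space borel {0..<1}"

definition circle_C2 :: "(real \<Rightarrow> real) \<Rightarrow> bool" where
  "circle_C2 \<psi> \<longleftrightarrow>
     (\<forall>x. \<psi> (x + 1) = \<psi> x) \<and>
     (\<forall>x. \<psi> differentiable (at x)) \<and>
     (\<forall>x. deriv \<psi> differentiable (at x)) \<and>
     continuous_on UNIV (deriv (deriv \<psi>))"

definition circle_crit :: "(real \<Rightarrow> real) \<Rightarrow> real set" where
  "circle_crit \<psi> = {c \<in> {0..<1}. deriv \<psi> c = 0}"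

definition tau :: "(real \<Rightarrow> real) \<Rightarrow> real \<Rightarrow> real \<Rightarrow> real \<Rightarrow> real" where
  "tau \<psi> L a x = frac (a + x + L * \<psi> x)"

text \<open>The derivative of \<open>tau \<psi> L a\<close> as a map of the circle, i.e. of its lift before reduction
  modulo 1; it does not depend on \<open>a\<close>.\<close>

definition tau_deriv :: "(real \<Rightarrow> real) \<Rightarrow> real \<Rightarrow> real \<Rightarrow> real" where
  "tau_deriv \<psi> L x = 1 + L * deriv \<psi> x"

definition tau_shift :: "(real \<Rightarrow> real) \<Rightarrow> real \<Rightarrow> real \<Rightarrow> real \<Rightarrow> real \<Rightarrow> real" where
  "tau_shift \<psi> L a w x = frac (tau \<psi> L a x + w)"

definition noise :: "real \<Rightarrow> real measure" where
  "noise \<epsilon> = uniform_measure lborel {-\<epsilon>..\<epsilon>}"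

definition noise_seq :: "real \<Rightarrow> (nat \<Rightarrow> real) measure" where
  "noise_seq \<epsilon> = PiM {1..} (\<lambda>_. noise \<epsilon>)"

definition invariant_measure ::
  "(real \<Rightarrow> real) \<Rightarrow> real \<Rightarrow> real \<Rightarrow> real \<Rightarrow> real measure \<Rightarrow> bool" where
  "invariant_measure \<psi> L a \<epsilon> \<mu> \<longleftrightarrow>
     prob_space \<mu> \<and> space \<mu> = {0..<1} \<and> sets \<mu> = sets circle_borel \<and>
     (\<forall>B \<in> sets circle_borel.
        emeasure \<mu> B = (\<integral>\<^sup>+ w. emeasure \<mu> (tau_shift \<psi> L a w -` B \<inter> {0..<1}) \<partial>noise \<epsilon>))"

primrec orbit :: "(real \<Rightarrow> real) \<Rightarrow> real \<Rightarrow> real \<Rightarrow> (nat \<Rightarrow> real) \<Rightarrow> real \<Rightarrow> nat \<Rightarrow> real" where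
  "orbit \<psi> L a \<omega> x 0 = x"
| "orbit \<psi> L a \<omega> x (Suc n) = tau_shift \<psi> L a (\<omega> (Suc n)) (orbit \<psi> L a \<omega> x n)"

text \<open>Logarithm of the absolute value with \<open>log 0 = -\<infinity>\<close>; the real function has \<open>ln 0 = 0\<close>.\<close>

definition log_abs :: "real \<Rightarrow> ereal" where
  "log_abs t = (if t = 0 then -\<infinity> else ereal (ln \<bar>t\<bar>))"

definition lyapunov_average ::
  "(real \<Rightarrow> real) \<Rightarrow> real \<Rightarrow> real \<Rightarrow> (nat \<Rightarrow> real) \<Rightarrow> real \<Rightarrow> nat \<Rightarrow> ereal" where
  "lyapunov_average \<psi> L a \<omega> x n =
     (\<Sum>k<n. log_abs (tau_deriv \<psi> L (orbit \<psi> L a \<omega> x k))) / ereal (real n)"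

text \<open>Only meaningful where \<open>lyapunov_average\<close> converges, as \<open>lim\<close> is unspecified otherwise.\<close>

definition lyapunov :: "(real \<Rightarrow> real) \<Rightarrow> real \<Rightarrow> real \<Rightarrow> (nat \<Rightarrow> real) \<Rightarrow> real \<Rightarrow> ereal" where
  "lyapunov \<psi> L a \<omega> x = lim (lyapunov_average \<psi> L a \<omega> x)"

text \<open>The \<open>\<sigma>\<close>-algebra of \<open>circle_borel\<close> is generated by the open sets of the quotient topology on
  the circle.\<close>

lemma sets_circle_borel:
  "sets circle_borel = sigma_sets {0..<1} {U. U \<subseteq> {0..<1} \<and> open (frac -` U)}"
    (is "_ = sigma_sets ?S ?G")
proof
  have "sets circle_borel = sigma_sets ?S ((\<lambda>V. V \<inter> ?S) ` {V::real set. open V})"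
  proof -
    have borel: "sets borel = sigma_sets UNIV {V::real set. open V}"
      by (simp add: borel_def)
    have "?S \<in> sigma_sets UNIV {V::real set. open V}"
      unfolding borel[symmetric] by simp
    then have "(\<inter>) ?S ` sigma_sets UNIV {V::real set. open V} =
        sigma_sets ?S ((\<inter>) ?S ` {V. open V})"
      by (rule sigma_sets_Int) simp
    then show ?thesis
      by (simp add: circle_borel_def sets_restrict_space borel Int_commute)
  qed
  moreover have "V \<inter> ?S \<in> sigma_sets ?S ?G" if V: "open V" for V :: "real set"
  proof -
    have *: "U \<in> sigma_sets ?S ?G" if "open U" "U \<subseteq> {0<..<1}" for U :: "real set"
    proof -
      have "frac -` U = (\<Union>i::int. (\<lambda>x. x - of_int i) -` U)"
      proof (intro equalityI subsetI)
        fix x :: real assume "x \<in> frac -` U"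
        then show "x \<in> (\<Union>i::int. (\<lambda>x. x - of_int i) -` U)"
          by (auto simp: frac_def)
      next
        fix x :: real assume "x \<in> (\<Union>i::int. (\<lambda>x. x - of_int i) -` U)"
        then obtain i :: int where i: "x - of_int i \<in> U" by auto
        with that have "0 < x - of_int i" "x - of_int i < 1" by auto
        then have "\<lfloor>x\<rfloor> = i" by linarith
        with i show "x \<in> frac -` U" by (simp add: frac_def)
      qed
      moreover have "open ((\<lambda>x. x - of_int i) -` U)" for i :: int
        using that(1) by (intro open_vimage continuous_intros)
      ultimately have "open (frac -` U)" by (auto intro: open_UN)
      with that show ?thesis by (intro sigma_sets.Basic) auto
    qed
    have 1: "V \<inter> {0<..<1} \<in> sigma_sets ?S ?G" using V by (intro *) auto
    have "?S - {0<..<1::real} \<in> sigma_sets ?S ?G" by (intro sigma_sets.Compl *) auto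
    moreover have "?S - {0<..<1::real} = {0}" by auto
    ultimately have "{0} \<in> sigma_sets ?S ?G" by simp
    then have "(V \<inter> {0<..<1}) \<union> {0} \<in> sigma_sets ?S ?G"
      using 1 by (intro sigma_sets_Un)
    moreover have "V \<inter> ?S = (if 0 \<in> V then (V \<inter> {0<..<1}) \<union> {0} else V \<inter> {0<..<1})"
      by (auto simp: less_le)
    ultimately show ?thesis using 1 by simp
  qed
  ultimately show "sets circle_borel \<subseteq> sigma_sets ?S ?G"
    by (auto intro!: sigma_sets_mono)
next
  show "sigma_sets ?S ?G \<subseteq> sets circle_borel"
  proof -
    have "U \<in> sets circle_borel" if "U \<subseteq> ?S" "open (frac -` U)" for U
    proof -
      have "U = ?S \<inter> frac -` U" using that(1) by (auto simp: frac_eq)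
      with that(2) show ?thesis
        unfolding circle_borel_def sets_restrict_space by (metis borel_open imageI)
    qed
    moreover have "space circle_borel = ?S" by (simp add: circle_borel_def space_restrict_space)
    ultimately show ?thesis
      using sets.sigma_sets_subset[of ?G circle_borel] by auto
  qed
qed

end

(* Let p be a zero of tau' = 1 + L psi', which exists for large L because psi' takes negative values,
   and choose a so that tau_a fixes p. With K bounding |psi''|, |tau'| <= K L |x - p|, so each tau_a + w with
   |w| <= 1 / (4 K L) sends the interval of radius 1 / (2 K L) around p into itself and contracts it
   by 1/2. Composing the random maps backwards in time therefore converges, and the law of the limit
   is an invariant measure mu supported where |tau'| <= 1/2, so every limit of the averages is at most
   -ln 2. The limit exists by Birkhoff's theorem for the skew product of the noise shift with
   the random map; that theorem comes from Garsia's maximal inequality, and for functions of one sign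
   it needs no integrability. *)
theory Submission
  imports Defs
begin

section \<open>Birkhoff averages of nonnegative functions\<close>

definition birkhoff_sum :: "('a \<Rightarrow> 'a) \<Rightarrow> ('a \<Rightarrow> real) \<Rightarrow> nat \<Rightarrow> 'a \<Rightarrow> real" where
  "birkhoff_sum T f n z = (\<Sum>k<n. f ((T ^^ k) z))"

lemma birkhoff_sum_0 [simp]: "birkhoff_sum T f 0 z = 0"
  by (simp add: birkhoff_sum_def)

lemma birkhoff_sum_Suc: "birkhoff_sum T f (Suc n) z = f z + birkhoff_sum T f n (T z)"
  by (simp add: birkhoff_sum_def sum.lessThan_Suc_shift funpow_Suc_right
      del: funpow.simps sum.lessThan_Suc)

lemma birkhoff_sum_diff_const:
  "birkhoff_sum T (\<lambda>z. f z - b) n z = birkhoff_sum T f n z - b * real n"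
  by (simp add: birkhoff_sum_def sum_subtractf)

lemma birkhoff_sum_const_diff:
  "birkhoff_sum T (\<lambda>z. b - f z) n z = b * real n - birkhoff_sum T f n z"
  by (simp add: birkhoff_sum_def sum_subtractf)

locale measure_preserving = prob_space M for M :: "'a measure" +
  fixes T :: "'a \<Rightarrow> 'a"
  assumes T_measurable [measurable]: "T \<in> measurable M M"
    and distr_T: "distr M M T = M"
begin

lemma funpow_measurable: "(T ^^ k) \<in> measurable M M"
proof (induction k)
  case (Suc k)
  then show ?case using measurable_comp[OF Suc T_measurable] by simp
qed (simp add: id_def)

text \<open>Preimages of null sets under a measure-preserving map are null, and there are only
  countably many iterates.\<close>

lemma AE_funpow:
  assumes "AE z in M. P z"
  shows "AE z in M. \<forall>k. P ((T ^^ k) z)"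
proof -
  have "AE z in M. P ((T ^^ k) z)" for k
  proof (induction k)
    case 0
    then show ?case using assms by simp
  next
    case (Suc k)
    then have "AE z in distr M M T. P ((T ^^ k) z)" unfolding distr_T .
    from AE_distrD[OF T_measurable this] show ?case
      by (simp add: funpow_Suc_right del: funpow.simps)
  qed
  then show ?thesis by (simp add: AE_all_countable)
qed

lemma birkhoff_sum_measurable [measurable]:
  "f \<in> borel_measurable M \<Longrightarrow> birkhoff_sum T f n \<in> borel_measurable M"
  unfolding birkhoff_sum_def[abs_def]
  by (intro borel_measurable_sum measurable_compose[OF funpow_measurable])

lemma integrable_T: "integrable M (h :: 'a \<Rightarrow> real) \<Longrightarrow> integrable M (\<lambda>z. h (T z))"
  using integrable_distr[of T M M h] by (simp add: distr_T)

lemma integral_T: "(h :: 'a \<Rightarrow> real) \<in> borel_measurable M \<Longrightarrow> (\<integral>z. h (T z) \<partial>M) = (\<integral>z. h z \<partial>M)"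
  using integral_distr[of T M M h] by (simp add: distr_T)

section \<open>Garsia's maximal inequality\<close>

text \<open>This is the maximum of the Birkhoff sums of lengths \<open>0\<close> to
  \<open>n\<close>. The recursive form puts \<open>h\<close> and the maximum at \<open>T z\<close>
  in view, which is what Garsia's argument compares.\<close>

primrec birkhoff_max :: "('a \<Rightarrow> real) \<Rightarrow> nat \<Rightarrow> 'a \<Rightarrow> real" where
  "birkhoff_max h 0 z = 0"
| "birkhoff_max h (Suc n) z = max 0 (h z + birkhoff_max h n (T z))"

lemma birkhoff_max_nonneg: "0 \<le> birkhoff_max h n z"
  by (cases n) auto

lemma birkhoff_max_mono: "birkhoff_max h n z \<le> birkhoff_max h (Suc n) z"
proof (induction n arbitrary: z)
  case (Suc n)
  have "birkhoff_max h (Suc n) z = max 0 (h z + birkhoff_max h n (T z))" by simp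
  also have "\<dots> \<le> max 0 (h z + birkhoff_max h (Suc n) (T z))" using Suc[of "T z"] by linarith
  finally show ?case by simp
qed simp

lemma integrable_birkhoff_max: "integrable M h \<Longrightarrow> integrable M (birkhoff_max h n)"
proof (induction n)
  case (Suc n)
  from Suc(2) integrable_T[OF Suc(1)[OF Suc(2)]]
  have "integrable M (\<lambda>z. h z + birkhoff_max h n (T z))"
    by (rule Bochner_Integration.integrable_add)
  then have "integrable M (\<lambda>z. max 0 (h z + birkhoff_max h n (T z)))" by simp
  then show ?case by simp
next
  case 0
  have "birkhoff_max h 0 = (\<lambda>z. 0)" by (rule ext) simp
  then show ?case by simp
qed

lemma birkhoff_sum_le_max: "birkhoff_sum T h n z \<le> birkhoff_max h n z"
  by (induction n arbitrary: z) (auto simp: birkhoff_sum_Suc intro: max.coboundedI2)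

lemma birkhoff_max_eq_sum: "\<exists>k. birkhoff_max h n z = birkhoff_sum T h k z"
proof (induction n arbitrary: z)
  case 0
  show ?case by (intro exI[of _ 0]) simp
next
  case (Suc n)
  obtain k where k: "birkhoff_max h n (T z) = birkhoff_sum T h k (T z)" using Suc by blast
  show ?case
  proof (cases "h z + birkhoff_max h n (T z) \<ge> 0")
    case True
    with k show ?thesis by (intro exI[of _ "Suc k"]) (simp add: birkhoff_sum_Suc)
  next
    case False
    then show ?thesis by (intro exI[of _ 0]) simp
  qed
qed

text \<open>For each length, the indicator of positivity of the maximum times \<open>h\<close>
  dominates the difference between the maximum and its composition with \<open>T\<close>, and that
  difference integrates to zero. The sets of positivity increase with the length, so dominated
  convergence with bound \<open>\<bar>h z\<bar>\<close> gives the claim.\<close>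

theorem maximal_ergodic:
  assumes h [measurable]: "integrable M h"
  shows "0 \<le> (\<integral>z. h z * indicator {z. \<exists>n. 0 < birkhoff_sum T h n z} z \<partial>M)"
proof (rule LIMSEQ_le_const)
  let ?E = "\<lambda>n. {z. 0 < birkhoff_max h n z}"
  have m [measurable]: "birkhoff_max h n \<in> borel_measurable M" for n
    using integrable_birkhoff_max[OF h] by blast
  have hm [measurable]: "h \<in> borel_measurable M" using h by blast
  have nz: "(\<exists>n. 0 < birkhoff_sum T h n z) \<longleftrightarrow> (\<exists>n. 0 < birkhoff_max h n z)" for z
    by (metis birkhoff_sum_le_max birkhoff_max_eq_sum less_le_trans)
  have incr: "birkhoff_max h i z \<le> birkhoff_max h j z" if "i \<le> j" for i j z
    using lift_Suc_mono_le[of "\<lambda>n. birkhoff_max h n z"] birkhoff_max_mono that by blast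
  have "(\<lambda>n. h z * indicator (?E n) z) \<longlonglongrightarrow> h z * indicator {z. \<exists>n. 0 < birkhoff_sum T h n z} z" for z
  proof (intro tendsto_mult tendsto_const)
    show "(\<lambda>n. indicator (?E n) z) \<longlonglongrightarrow> (indicator {z. \<exists>n. 0 < birkhoff_sum T h n z} z :: real)"
    proof (cases "\<exists>n. 0 < birkhoff_max h n z")
      case True
      then obtain n where "0 < birkhoff_max h n z" by blast
      then have "0 < birkhoff_max h m z" if "m \<ge> n" for m using incr[OF that, of z] by linarith
      then have "\<forall>\<^sub>F m in sequentially. indicator (?E m) z = (1 :: real)"
        by (auto simp: eventually_sequentially intro!: exI[of _ n])
      then show ?thesis using True by (intro tendsto_eventually) (auto simp: nz indicator_def)
    next
      case False
      then show ?thesis by (auto simp: nz indicator_def)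
    qed
  qed
  then show "(\<lambda>n. \<integral>z. h z * indicator (?E n) z \<partial>M)
      \<longlonglongrightarrow> (\<integral>z. h z * indicator {z. \<exists>n. 0 < birkhoff_sum T h n z} z \<partial>M)"
    using h by (intro integral_dominated_convergence[where w = "\<lambda>z. \<bar>h z\<bar>"])
      (auto simp: indicator_def)
  have "0 \<le> (\<integral>z. h z * indicator (?E (Suc n)) z \<partial>M)" for n
  proof -
    let ?m = "birkhoff_max h (Suc n)"
    have int: "integrable M ?m" by (rule integrable_birkhoff_max[OF h])
    \<comment> \<open>Invariance of the measure gives \<open>?m\<close> and its composition with
      \<open>T\<close> the same integral.\<close>
    have "0 = (\<integral>z. ?m z \<partial>M) - (\<integral>z. ?m (T z) \<partial>M)"
      by (subst integral_T) (auto simp del: birkhoff_max.simps)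
    also have "\<dots> = (\<integral>z. ?m z - ?m (T z) \<partial>M)"
      using int integrable_T[OF int] by (intro Bochner_Integration.integral_diff[symmetric])
    also have "\<dots> \<le> (\<integral>z. h z * indicator (?E (Suc n)) z \<partial>M)"
    proof (rule integral_mono)
      show "integrable M (\<lambda>z. ?m z - ?m (T z))"
        using int integrable_T[OF int] by (rule Bochner_Integration.integrable_diff)
      show "integrable M (\<lambda>z. h z * indicator (?E (Suc n)) z)"
        by (rule Bochner_Integration.integrable_bound[OF h]) (auto simp: indicator_def simp del: birkhoff_max.simps)
    next
      fix z
      \<comment> \<open>Where \<open>?m z\<close> is positive it equals
        \<open>h z + birkhoff_max h n (T z)\<close>, and monotonicity in the length applies; where
        it is zero, nonnegativity of \<open>?m (T z)\<close> is enough.\<close>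
      have "birkhoff_max h n (T z) \<le> ?m (T z)" "0 \<le> ?m (T z)"
        by (rule birkhoff_max_mono birkhoff_max_nonneg)+
      then show "?m z - ?m (T z) \<le> h z * indicator (?E (Suc n)) z"
        unfolding birkhoff_max.simps(2)[of h n z] by (auto simp: indicator_def max_def)
    qed
    finally show ?thesis .
  qed
  then show "\<exists>N. \<forall>n\<ge>N. 0 \<le> (\<integral>z. h z * indicator (?E n) z \<partial>M)"
    by (intro exI[of _ 1]) (metis Suc_le_D One_nat_def)
qed

section \<open>Almost sure convergence through oscillation sets\<close>

text \<open>On an invariant set the Birkhoff sums of \<open>h z * indicator E z\<close> agree with
  those of \<open>h\<close>, and off it they vanish. Within the space, some sum is therefore
  positive exactly on \<open>E\<close>. Integrability is asked on \<open>E\<close> only, because an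
  unbounded \<open>f\<close> is later controlled just there.\<close>

lemma maximal_ergodic_invariant:
  assumes h: "integrable M (\<lambda>z. h z * indicator E z)"
    and inv: "\<And>z. z \<in> space M \<Longrightarrow> T z \<in> E \<longleftrightarrow> z \<in> E"
    and pos: "\<And>z. z \<in> E \<Longrightarrow> \<exists>n. 0 < birkhoff_sum T h n z"
  shows "0 \<le> (\<integral>z. h z * indicator E z \<partial>M)"
proof -
  let ?h = "\<lambda>z. h z * indicator E z"
  have sum: "birkhoff_sum T ?h n z = birkhoff_sum T h n z * indicator E z" if "z \<in> space M" for n z
    using that
  proof (induction n arbitrary: z)
    case (Suc n)
    have "T z \<in> space M" using Suc(2) by (rule measurable_space[OF T_measurable])
    with Suc inv[OF Suc(2)] show ?case by (simp add: birkhoff_sum_Suc indicator_def)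
  qed simp
  have "?h z * indicator {z. \<exists>n. 0 < birkhoff_sum T ?h n z} z = ?h z" if "z \<in> space M" for z
  proof (cases "z \<in> E")
    case True
    then have "z \<in> {z. \<exists>n. 0 < birkhoff_sum T ?h n z}" using pos[of z] sum[OF that] by auto
    then show ?thesis by simp
  qed simp
  then have "(\<integral>z. ?h z * indicator {z. \<exists>n. 0 < birkhoff_sum T ?h n z} z \<partial>M) = (\<integral>z. ?h z \<partial>M)"
    by (intro Bochner_Integration.integral_cong refl)
  then show ?thesis using maximal_ergodic[OF h] by simp
qed

text \<open>Points with \<open>liminf < a\<close> and \<open>limsup > b\<close> of the averages lie in this set. Unlike those
  conditions, unboundedness is unaffected by the first term of a sum, so invariance is immediate.\<close>

definition oscillation_set :: "('a \<Rightarrow> real) \<Rightarrow> real \<Rightarrow> real \<Rightarrow> 'a set" where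
  "oscillation_set f a b = {z \<in> space M.
     (\<forall>C::nat. \<exists>n. real C < birkhoff_sum T f n z - b * real n) \<and>
     (\<forall>C::nat. \<exists>n. real C < a * real n - birkhoff_sum T f n z)}"

lemma oscillation_set_measurable [measurable]:
  "f \<in> borel_measurable M \<Longrightarrow> oscillation_set f a b \<in> sets M"
  unfolding oscillation_set_def
  by (intro sets.sets_Collect sets.sets_Collect_countable_All sets.sets_Collect_countable_Ex
      borel_measurable_less borel_measurable_diff borel_measurable_const birkhoff_sum_measurable)

text \<open>The sums \<open>S (Suc n) z\<close> and \<open>S n (T z)\<close> differ by the fixed
  number \<open>g z\<close>, so raising the bound by its absolute value trades one for the
  other.\<close>

lemma unbounded_birkhoff_sum_T:
  assumes "\<And>n z. S (Suc n) z = g z + S n (T z)" and "\<And>z. S 0 z = (0 :: real)"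
  shows "(\<forall>C::nat. \<exists>n. real C < S n (T z)) \<longleftrightarrow> (\<forall>C::nat. \<exists>n. real C < S n z)"
proof safe
  fix C :: nat
  assume *: "\<forall>C::nat. \<exists>n. real C < S n (T z)"
  obtain C' :: nat where "real C + \<bar>g z\<bar> \<le> real C'" using real_arch_simple by blast
  moreover obtain n where "real C' < S n (T z)" using * by blast
  ultimately show "\<exists>n. real C < S n z" by (intro exI[of _ "Suc n"]) (auto simp: assms(1))
next
  fix C :: nat
  assume *: "\<forall>C::nat. \<exists>n. real C < S n z"
  obtain C' :: nat where C': "real C + \<bar>g z\<bar> \<le> real C'" using real_arch_simple by blast
  obtain n where n: "real C' < S n z" using * by blast
  \<comment> \<open>The bound is nonnegative and \<open>S 0 z\<close> is zero, so the sum that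
    exceeds it has a first term to drop.\<close>
  with assms(2)[of z] have "n \<noteq> 0" by (cases n) auto
  then obtain m where "n = Suc m" using not0_implies_Suc by blast
  with n C' show "\<exists>n. real C < S n (T z)" by (intro exI[of _ m]) (auto simp: assms(1))
qed

lemma oscillation_set_invariant:
  assumes "z \<in> space M"
  shows "T z \<in> oscillation_set f a b \<longleftrightarrow> z \<in> oscillation_set f a b"
proof -
  have "(\<forall>C::nat. \<exists>n. real C < birkhoff_sum T (\<lambda>z. f z - b) n (T z)) \<longleftrightarrow>
      (\<forall>C::nat. \<exists>n. real C < birkhoff_sum T (\<lambda>z. f z - b) n z)"
    by (rule unbounded_birkhoff_sum_T) (auto simp: birkhoff_sum_Suc)
  moreover have "(\<forall>C::nat. \<exists>n. real C < birkhoff_sum T (\<lambda>z. a - f z) n (T z)) \<longleftrightarrow>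
      (\<forall>C::nat. \<exists>n. real C < birkhoff_sum T (\<lambda>z. a - f z) n z)"
    by (rule unbounded_birkhoff_sum_T) (auto simp: birkhoff_sum_Suc)
  moreover have "T z \<in> space M" using assms by (rule measurable_space[OF T_measurable])
  ultimately show ?thesis
    using assms by (simp add: oscillation_set_def birkhoff_sum_diff_const birkhoff_sum_const_diff)
qed

text \<open>The maximal inequality on the oscillation set, applied to \<open>a - f\<close> and to
  \<open>f - b\<close>, bounds the integral of \<open>f\<close> there above by \<open>a\<close> and
  below by \<open>b\<close> times the measure of the set; with \<open>a < b\<close> the measure is
  zero. As \<open>f\<close> may have infinite integral, the upper bound comes first, for truncations
  of \<open>f\<close>, and it yields integrability on the set.\<close>

lemma oscillation_set_null:
  assumes f [measurable]: "f \<in> borel_measurable M" and nonneg: "\<And>z. 0 \<le> f z" and "a < b"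
  shows "AE z in M. z \<notin> oscillation_set f a b"
proof -
  let ?E = "oscillation_set f a b"
  let ?p = "measure M ?E"
  have trunc: "(\<integral>z. min (f z) (real m) * indicator ?E z \<partial>M) \<le> a * ?p" for m
  proof -
    have int: "integrable M (\<lambda>z. min (f z) (real m) * indicator ?E z)"
      by (rule integrable_const_bound[where B = "real m"])
        (auto simp: indicator_def nonneg intro!: abs_leI)
    have inta: "integrable M (\<lambda>z. a * indicator ?E z)" by (simp add: less_top[symmetric])
    have "0 \<le> (\<integral>z. (a - min (f z) (real m)) * indicator ?E z \<partial>M)"
    proof (rule maximal_ergodic_invariant)
      show "integrable M (\<lambda>z. (a - min (f z) (real m)) * indicator ?E z)"
        using Bochner_Integration.integrable_diff[OF inta int] by (simp add: algebra_simps)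
    next
      fix z assume "z \<in> ?E"
      then obtain n where "real 0 < a * real n - birkhoff_sum T f n z"
        unfolding oscillation_set_def by blast
      \<comment> \<open>Truncation only lowers the sums, so a positive value of
        \<open>a * real n - birkhoff_sum T f n z\<close> survives it.\<close>
      moreover have "birkhoff_sum T (\<lambda>z. min (f z) (real m)) n z \<le> birkhoff_sum T f n z"
        unfolding birkhoff_sum_def by (intro sum_mono) simp
      ultimately show "\<exists>n. 0 < birkhoff_sum T (\<lambda>z. a - min (f z) (real m)) n z"
        by (intro exI[of _ n]) (simp add: birkhoff_sum_const_diff)
    qed (rule oscillation_set_invariant)
    also have "\<dots> = (\<integral>z. a * indicator ?E z \<partial>M) - (\<integral>z. min (f z) (real m) * indicator ?E z \<partial>M)"
      using Bochner_Integration.integral_diff[OF inta int] by (simp add: algebra_simps)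
    finally show ?thesis by simp
  qed
  have mono: "AE z in M. mono (\<lambda>m. min (f z) (real m) * indicator ?E z)"
    by (auto simp: mono_def indicator_def)
  have lim: "AE z in M. (\<lambda>m. min (f z) (real m) * indicator ?E z) \<longlonglongrightarrow> f z * indicator ?E z"
  proof (intro AE_I2 tendsto_mult tendsto_const)
    fix z
    obtain k :: nat where "f z \<le> real k" using real_arch_simple by blast
    then show "(\<lambda>m. min (f z) (real m)) \<longlonglongrightarrow> f z"
      by (intro tendsto_eventually) (auto simp: eventually_sequentially intro!: exI[of _ k])
  qed
  have int: "integrable M (\<lambda>z. min (f z) (real m) * indicator ?E z)" for m
    by (rule integrable_const_bound[where B = "real m"])
      (auto simp: indicator_def nonneg intro!: abs_leI)
  have "(\<integral>z. min (f z) (real m) * indicator ?E z \<partial>M) \<le> (\<integral>z. min (f z) (real n) * indicator ?E z \<partial>M)"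
    if "m \<le> n" for m n
    using that by (intro integral_mono int mult_right_mono) auto
  then have "convergent (\<lambda>m. \<integral>z. min (f z) (real m) * indicator ?E z \<partial>M)"
    using trunc
    by (intro Bseq_mono_convergent BseqI'[where K = "\<bar>a * ?p\<bar>"])
      (auto simp: nonneg intro!: order_trans[OF _ abs_ge_self])
  then obtain l where l: "(\<lambda>m. \<integral>z. min (f z) (real m) * indicator ?E z \<partial>M) \<longlonglongrightarrow> l"
    by (auto simp: convergent_def)
  have meas: "(\<lambda>z. f z * indicator ?E z) \<in> borel_measurable M"
    by (intro borel_measurable_times borel_measurable_indicator oscillation_set_measurable f)
  \<comment> \<open>The integrals of the truncations increase and are bounded by
    \<open>trunc\<close>, so monotone convergence applies.\<close>
  have fE: "integrable M (\<lambda>z. f z * indicator ?E z)"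
    by (rule integrable_monotone_convergence[OF int mono lim l meas])
  have fEl: "(\<integral>z. f z * indicator ?E z \<partial>M) = l"
    by (rule integral_monotone_convergence[OF int mono lim l meas])
  have upper: "(\<integral>z. f z * indicator ?E z \<partial>M) \<le> a * ?p"
    unfolding fEl using l trunc by (intro LIMSEQ_le_const2[OF l]) auto
  have intb: "integrable M (\<lambda>z. b * indicator ?E z)" by (simp add: less_top[symmetric])
  have "0 \<le> (\<integral>z. (f z - b) * indicator ?E z \<partial>M)"
  proof (rule maximal_ergodic_invariant)
    show "integrable M (\<lambda>z. (f z - b) * indicator ?E z)"
      using Bochner_Integration.integrable_diff[OF fE intb] by (simp add: algebra_simps)
  next
    fix z assume "z \<in> ?E"
    then obtain n where "real 0 < birkhoff_sum T f n z - b * real n"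
      unfolding oscillation_set_def by blast
    then show "\<exists>n. 0 < birkhoff_sum T (\<lambda>z. f z - b) n z"
      by (intro exI[of _ n]) (simp add: birkhoff_sum_diff_const)
  qed (rule oscillation_set_invariant)
  also have "\<dots> = (\<integral>z. f z * indicator ?E z \<partial>M) - b * ?p"
    using Bochner_Integration.integral_diff[OF fE intb] by (simp add: algebra_simps)
  finally have "b * ?p \<le> a * ?p" using upper by simp
  with \<open>a < b\<close> have "?p = 0"
    using measure_nonneg[of M ?E] by (smt (verit) mult_less_cancel_right)
  then show ?thesis
    by (intro AE_not_in) (simp add: null_sets_def emeasure_eq_measure)
qed

text \<open>A strict inequality for the limsup leaves room for some \<open>b'\<close> above
  \<open>b\<close>. Infinitely many averages exceed \<open>b'\<close>, and at those times the sum
  exceeds \<open>b * real n\<close> by more than \<open>(b' - b) * real n\<close>, which is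
  unbounded. The liminf is treated symmetrically.\<close>

lemma average_gap_oscillation:
  assumes "z \<in> space M"
    and "liminf (\<lambda>n. ereal (birkhoff_sum T f n z / real n)) < ereal a"
    and "ereal b < limsup (\<lambda>n. ereal (birkhoff_sum T f n z / real n))"
  shows "z \<in> oscillation_set f a b"
proof -
  let ?S = "\<lambda>n. birkhoff_sum T f n z"
  have "\<exists>n. real C < ?S n - b * real n" for C
  proof -
    obtain b' where b': "b < b'" "ereal b' < limsup (\<lambda>n. ereal (?S n / real n))"
      using ereal_dense2[OF assms(3)] by auto
    obtain N :: nat where N: "real C / (b' - b) < real N" using reals_Archimedean2 by blast
    have "\<not> (\<forall>\<^sub>F n in sequentially. ereal (?S n / real n) \<le> ereal b')"
      using b'(2) Limsup_bounded[of "\<lambda>n. ereal (?S n / real n)" "ereal b'" sequentially] by auto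
    \<comment> \<open>Taking \<open>Suc N\<close> makes \<open>n\<close> positive, so that the
      denominator can be cleared.\<close>
    then obtain n where n: "n \<ge> Suc N" "b' < ?S n / real n"
      unfolding eventually_sequentially by (metis ereal_less_eq(3) not_le)
    have "real C < (b' - b) * real N" using N b'(1) by (simp add: field_simps)
    also have "\<dots> \<le> (b' - b) * real n" using n(1) b'(1) by (intro mult_left_mono) auto
    finally have "b * real n + real C < b' * real n" by (simp add: algebra_simps)
    moreover have "b' * real n < ?S n" using n by (simp add: field_simps)
    ultimately show ?thesis by (intro exI[of _ n]) linarith
  qed
  moreover have "\<exists>n. real C < a * real n - ?S n" for C
  proof -
    obtain a' where a': "a' < a" "liminf (\<lambda>n. ereal (?S n / real n)) < ereal a'"
      using ereal_dense2[OF assms(2)] by auto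
    obtain N :: nat where N: "real C / (a - a') < real N" using reals_Archimedean2 by blast
    have "\<not> (\<forall>\<^sub>F n in sequentially. ereal a' \<le> ereal (?S n / real n))"
      using a'(2) Liminf_bounded[of "ereal a'" "\<lambda>n. ereal (?S n / real n)" sequentially] by auto
    then obtain n where n: "n \<ge> Suc N" "?S n / real n < a'"
      unfolding eventually_sequentially by (metis ereal_less_eq(3) not_le)
    have "real C < (a - a') * real N" using N a'(1) by (simp add: field_simps)
    also have "\<dots> \<le> (a - a') * real n" using n(1) a'(1) by (intro mult_left_mono) auto
    finally have "a' * real n + real C < a * real n" by (simp add: algebra_simps)
    moreover have "?S n < a' * real n" using n by (simp add: field_simps)
    ultimately show ?thesis by (intro exI[of _ n]) linarith
  qed
  ultimately show ?thesis using assms(1) by (simp add: oscillation_set_def)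
qed

text \<open>If the averages oscillate, two rationals separate liminf from limsup, and the countably
  many oscillation sets with rational levels are null. Convergence is in \<open>ereal\<close>, so
  the limit may be infinite.\<close>

theorem birkhoff_nonneg:
  assumes f [measurable]: "f \<in> borel_measurable M" and nonneg: "\<And>z. 0 \<le> f z"
  shows "AE z in M. convergent (\<lambda>n. ereal (birkhoff_sum T f n z / real n))"
proof -
  have "AE z in M. \<forall>a\<in>\<rat>. \<forall>b\<in>\<rat>. a < b \<longrightarrow> z \<notin> oscillation_set f a b"
    using oscillation_set_null[OF f nonneg] by (simp add: AE_ball_countable countable_rat)
  with AE_space show ?thesis
  proof eventually_elim
    case (elim z)
    let ?A = "\<lambda>n. ereal (birkhoff_sum T f n z / real n)"
    have "limsup ?A \<le> liminf ?A"
    proof (rule ccontr)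
      assume "\<not> ?thesis"
      then have "liminf ?A < limsup ?A" by (rule not_le_imp_less)
      then obtain a :: rat where a: "liminf ?A < ereal (real_of_rat a)"
          "ereal (real_of_rat a) < limsup ?A"
        using ereal_dense3 by blast
      obtain b :: rat where "real_of_rat a < real_of_rat b" "ereal (real_of_rat b) < limsup ?A"
        using ereal_dense3[OF a(2)] by (auto simp del: of_rat_less)
      with a(1) average_gap_oscillation elim show False by (meson Rats_of_rat)
    qed
    moreover have "liminf ?A \<le> limsup ?A" by (rule Liminf_le_Limsup) simp
    ultimately show ?case unfolding convergent_ereal by (rule antisym)
  qed
qed

end


section \<open>Random maps driven by independent noise\<close>

text \<open>Restriction to \<open>{1..}\<close> keeps the shifted sequence among the extensional
  functions that form the space of \<open>PiM {1..}\<close>.\<close>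

definition shift_seq :: "(nat \<Rightarrow> 'b) \<Rightarrow> nat \<Rightarrow> 'b" where
  "shift_seq \<omega> = (\<lambda>n\<in>{1..}. \<omega> (Suc n))"

lemma shift_seq_apply: "1 \<le> n \<Longrightarrow> shift_seq \<omega> n = \<omega> (Suc n)"
  by (simp add: shift_seq_def)

lemma shift_seq_measurable [measurable]:
  "shift_seq \<in> measurable (PiM {1..} (\<lambda>_. N)) (PiM {1..} (\<lambda>_. N))"
  unfolding shift_seq_def[abs_def]
  by (intro measurable_restrict measurable_component_singleton) auto

lemma head_measurable:
  "(\<lambda>\<omega>. \<omega> (1::nat)) \<in> measurable (PiM {1..} (\<lambda>_. N)) N"
  by (intro measurable_component_singleton) auto

text \<open>The first noise and the shifted remaining noise are independent, with laws
  \<open>N\<close> and \<open>S\<close>. To see this, the product over \<open>{1..}\<close> is split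
  into the factor at \<open>1\<close> and the product over \<open>{2..}\<close>, which reindexing by
  \<open>Suc\<close> turns into \<open>S\<close>.\<close>

lemma distr_head_shift:
  assumes "prob_space N"
  defines "S \<equiv> PiM {1::nat..} (\<lambda>_. N)"
  shows "distr S (N \<Otimes>\<^sub>M S) (\<lambda>\<omega>. (\<omega> 1, shift_seq \<omega>)) = N \<Otimes>\<^sub>M S"
proof -
  let ?P = "PiM {2::nat..} (\<lambda>_. N)"
  interpret S: prob_space S unfolding S_def using assms(1) by (intro prob_space_PiM)
  have ins: "insert 1 {2::nat..} = {1..}" by auto
  have [measurable]: "shift_seq \<in> measurable ?P S"
    unfolding shift_seq_def[abs_def] S_def
    by (intro measurable_restrict measurable_component_singleton) auto
  have upd: "(\<lambda>(x, X). X(1 := x)) \<in> measurable (N \<Otimes>\<^sub>M ?P) S"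
    unfolding S_def split_beta'
    by (rule measurable_fun_upd[OF _ measurable_snd measurable_fst]) auto
  have meas: "(\<lambda>\<omega>. (\<omega> 1, shift_seq \<omega>)) \<in> measurable S (N \<Otimes>\<^sub>M S)"
    unfolding S_def by (intro measurable_Pair head_measurable shift_seq_measurable)
  have S: "distr (N \<Otimes>\<^sub>M ?P) S (\<lambda>(x, X). X(1 := x)) = S"
    using distr_pair_PiM_eq_PiM[of "{2::nat..}" "\<lambda>_. N" 1] assms(1) unfolding ins S_def by blast
  have P: "distr ?P S shift_seq = S"
    using distr_PiM_reindex[of "{2::nat..}" "\<lambda>_. N" Suc "{1..}"] assms(1)
    by (simp add: S_def shift_seq_def[abs_def])
  have "distr S (N \<Otimes>\<^sub>M S) (\<lambda>\<omega>. (\<omega> 1, shift_seq \<omega>)) =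
      distr (distr (N \<Otimes>\<^sub>M ?P) S (\<lambda>(x, X). X(1 := x))) (N \<Otimes>\<^sub>M S) (\<lambda>\<omega>. (\<omega> 1, shift_seq \<omega>))"
    by (simp only: S)
  also have "\<dots> = distr (N \<Otimes>\<^sub>M ?P) (N \<Otimes>\<^sub>M S) ((\<lambda>\<omega>. (\<omega> 1, shift_seq \<omega>)) \<circ> (\<lambda>(x, X). X(1 := x)))"
    using meas upd by (rule distr_distr)
  also have "(\<lambda>\<omega>. (\<omega> 1, shift_seq \<omega>)) \<circ> (\<lambda>(x, X). X(1 := x)) = (\<lambda>(x, X). (x, shift_seq X))"
    by (auto simp: shift_seq_def fun_eq_iff)
  also have "distr (N \<Otimes>\<^sub>M ?P) (N \<Otimes>\<^sub>M S) (\<lambda>(x, X). (x, shift_seq X)) =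
      distr N N (\<lambda>x. x) \<Otimes>\<^sub>M distr ?P S shift_seq"
    by (rule pair_measure_distr[symmetric]) (auto simp: P intro: S.sigma_finite_measure_axioms)
  also have "\<dots> = N \<Otimes>\<^sub>M S" by (simp add: P distr_id)
  finally show ?thesis .
qed

text \<open>It suffices to measure rectangles. The fibre map uses only the first noise and the base
  only the later ones; independence factors the measure, and stationarity averages the fibre part to
  \<open>emeasure \<mu> B\<close>.\<close>

lemma skew_product_measure_preserving:
  fixes F :: "'b \<Rightarrow> 'c \<Rightarrow> 'c"
  assumes N: "prob_space N" and \<mu>: "prob_space \<mu>"
    and F: "(\<lambda>(w, x). F w x) \<in> measurable (N \<Otimes>\<^sub>M \<mu>) \<mu>"
    and stationary: "\<And>B. B \<in> sets \<mu> \<Longrightarrow>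
      emeasure \<mu> B = (\<integral>\<^sup>+ w. emeasure \<mu> (F w -` B \<inter> space \<mu>) \<partial>N)"
  defines "S \<equiv> PiM {1::nat..} (\<lambda>_. N)"
  shows "measure_preserving (S \<Otimes>\<^sub>M \<mu>) (\<lambda>(\<omega>, x). (shift_seq \<omega>, F (\<omega> 1) x))"
proof -
  let ?T = "\<lambda>(\<omega>, x). (shift_seq \<omega>, F (\<omega> (1::nat)) x)"
  interpret S: prob_space S unfolding S_def using N by (intro prob_space_PiM)
  interpret \<mu>: prob_space \<mu> by fact
  interpret N: prob_space N by fact
  interpret pair_prob_space S \<mu> ..
  have head: "(\<lambda>\<omega>. \<omega> 1) \<in> measurable S N" unfolding S_def by (rule head_measurable)
  have shift [measurable]: "shift_seq \<in> measurable S S"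
    unfolding S_def by (rule shift_seq_measurable)
  have "(\<lambda>z. (fst z 1, snd z)) \<in> measurable (S \<Otimes>\<^sub>M \<mu>) (N \<Otimes>\<^sub>M \<mu>)"
    by (intro measurable_Pair measurable_snd measurable_compose[OF measurable_fst head])
  from measurable_compose[OF this F]
  have "(\<lambda>z. F (fst z 1) (snd z)) \<in> measurable (S \<Otimes>\<^sub>M \<mu>) \<mu>" by simp
  then have T: "?T \<in> measurable (S \<Otimes>\<^sub>M \<mu>) (S \<Otimes>\<^sub>M \<mu>)" by (simp add: split_beta')
  have "S \<Otimes>\<^sub>M \<mu> = distr (S \<Otimes>\<^sub>M \<mu>) (S \<Otimes>\<^sub>M \<mu>) ?T"
  proof (rule pair_measure_eqI)
    fix A B assume A [measurable]: "A \<in> sets S" and B: "B \<in> sets \<mu>"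
    define Q where "Q = (\<lambda>(w, x). F w x) -` B \<inter> space (N \<Otimes>\<^sub>M \<mu>)"
    have Q: "Q \<in> sets (N \<Otimes>\<^sub>M \<mu>)" unfolding Q_def using F B by (rule measurable_sets)
    \<comment> \<open>Written through sections of the measurable set \<open>Q\<close>, the integrand
      of the stationarity equation is seen to be measurable in the noise.\<close>
    define g where "g w = emeasure \<mu> (Pair w -` Q)" for w
    have g [measurable]: "g \<in> borel_measurable N"
      unfolding g_def using Q by (rule \<mu>.measurable_emeasure_Pair)
    have g_eq: "g w = emeasure \<mu> (F w -` B \<inter> space \<mu>)" if "w \<in> space N" for w
      unfolding g_def Q_def using that
      by (intro arg_cong[where f = "emeasure \<mu>"]) (auto simp: space_pair_measure)
    let ?h = "\<lambda>(w, \<omega>). indicator A \<omega> * g w"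
    have "emeasure (distr (S \<Otimes>\<^sub>M \<mu>) (S \<Otimes>\<^sub>M \<mu>) ?T) (A \<times> B) =
        emeasure (S \<Otimes>\<^sub>M \<mu>) (?T -` (A \<times> B) \<inter> space (S \<Otimes>\<^sub>M \<mu>))"
      using T A B by (intro emeasure_distr) auto
    also have "\<dots> = (\<integral>\<^sup>+ \<omega>. emeasure \<mu> (Pair \<omega> -` (?T -` (A \<times> B) \<inter> space (S \<Otimes>\<^sub>M \<mu>))) \<partial>S)"
      using T A B by (intro \<mu>.emeasure_pair_measure_alt measurable_sets) auto
    also have "\<dots> = (\<integral>\<^sup>+ \<omega>. ?h (\<omega> 1, shift_seq \<omega>) \<partial>S)"
    proof (rule nn_integral_cong)
      fix \<omega> assume \<omega>: "\<omega> \<in> space S"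
      have "Pair \<omega> -` (?T -` (A \<times> B) \<inter> space (S \<Otimes>\<^sub>M \<mu>)) =
          (if shift_seq \<omega> \<in> A then F (\<omega> 1) -` B \<inter> space \<mu> else {})"
        using \<omega> by (auto simp: space_pair_measure)
      with measurable_space[OF head \<omega>]
      show "emeasure \<mu> (Pair \<omega> -` (?T -` (A \<times> B) \<inter> space (S \<Otimes>\<^sub>M \<mu>))) = ?h (\<omega> 1, shift_seq \<omega>)"
        by (simp add: g_eq)
    qed
    \<comment> \<open>The integrand depends on \<omega> only through its head and its shift, whose
      joint law is a product.\<close>
    also have "\<dots> = (\<integral>\<^sup>+ z. ?h z \<partial>distr S (N \<Otimes>\<^sub>M S) (\<lambda>\<omega>. (\<omega> 1, shift_seq \<omega>)))"
      by (intro nn_integral_distr[symmetric] measurable_Pair head shift) measurable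
    also have "\<dots> = (\<integral>\<^sup>+ z. ?h z \<partial>(N \<Otimes>\<^sub>M S))"
      using distr_head_shift[OF N] by (simp add: S_def)
    also have "\<dots> = (\<integral>\<^sup>+ w. \<integral>\<^sup>+ \<omega>. ?h (w, \<omega>) \<partial>S \<partial>N)"
      by (intro S.nn_integral_fst[symmetric]) measurable
    also have "\<dots> = (\<integral>\<^sup>+ w. emeasure S A * g w \<partial>N)"
      by (simp add: nn_integral_multc)
    also have "\<dots> = emeasure S A * (\<integral>\<^sup>+ w. g w \<partial>N)"
      by (rule nn_integral_cmult) measurable
    also have "(\<integral>\<^sup>+ w. g w \<partial>N) = emeasure \<mu> B"
      unfolding stationary[OF B] by (intro nn_integral_cong g_eq)
    finally show "emeasure S A * emeasure \<mu> B =
        emeasure (distr (S \<Otimes>\<^sub>M \<mu>) (S \<Otimes>\<^sub>M \<mu>) ?T) (A \<times> B)" by simp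
  qed (auto intro: S.sigma_finite_measure_axioms \<mu>.sigma_finite_measure_axioms)
  then show ?thesis
    using T prob_space_axioms by (simp add: measure_preserving_def measure_preserving_axioms_def)
qed

section \<open>The uniform noise\<close>

lemma sets_noise [simp, measurable_cong]: "sets (noise \<epsilon>) = sets borel"
  by (simp add: noise_def)

lemma space_noise [simp]: "space (noise \<epsilon>) = UNIV"
  by (simp add: noise_def)

lemma prob_space_noise: "0 < \<epsilon> \<Longrightarrow> prob_space (noise \<epsilon>)"
  unfolding noise_def by (intro prob_space_uniform_measure) auto

lemma head_noise_measurable: "(\<lambda>\<omega>. \<omega> 1) \<in> measurable (noise_seq \<epsilon>) (noise \<epsilon>)"
  unfolding noise_seq_def by (rule head_measurable)

lemma shift_noise_measurable: "shift_seq \<in> measurable (noise_seq \<epsilon>) (noise_seq \<epsilon>)"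
  unfolding noise_seq_def by measurable

lemma AE_noise: "AE w in noise \<epsilon>. w \<in> {-\<epsilon>..\<epsilon>}"
  unfolding noise_def by (intro AE_uniform_measureI) auto

section \<open>The stationary measure near an attracting fixed point\<close>

lemma frac_measurable: "frac \<in> measurable borel circle_borel"
  unfolding circle_borel_def
proof (rule measurable_restrict_space2)
  show "frac \<in> borel_measurable (borel :: real measure)"
    unfolding frac_def[abs_def] by measurable
qed (auto simp: frac_lt_1)

lemma space_circle_borel: "space circle_borel = {0..<1}"
  by (simp add: circle_borel_def space_restrict_space)

lemma circle_borel_measurable: "f \<in> borel_measurable borel \<Longrightarrow> f \<in> borel_measurable circle_borel"
  unfolding circle_borel_def by (rule measurable_restrict_space1)

section \<open>Periodic functions and lifts to the line\<close>

lemma periodic_frac: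
  fixes f :: "real \<Rightarrow> 'b"
  assumes "\<And>x. f (x + 1) = f x"
  shows "f (frac x) = f x"
proof -
  interpret periodic_fun_simple' f using assms by unfold_locales
  show ?thesis unfolding frac_def by (rule minus_of_int)
qed

lemma periodic_deriv:
  fixes f :: "real \<Rightarrow> real"
  assumes "\<And>x. f (x + 1) = f x"
  shows "deriv f (x + 1) = deriv f x"
proof -
  have "(\<lambda>x. f (x + 1)) = f" using assms by auto
  then show ?thesis
    unfolding deriv_def using DERIV_shift[of f _ x 1] by simp
qed

lemma periodic_continuous_bounded:
  fixes f :: "real \<Rightarrow> real"
  assumes "\<And>x. f (x + 1) = f x" and "continuous_on UNIV f"
  obtains K where "0 < K" "\<And>x. \<bar>f x\<bar> \<le> K"
proof -
  have "bounded (f ` {0..1})"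
    using assms(2) by (intro compact_imp_bounded compact_continuous_image) (auto intro: continuous_on_subset)
  then obtain K where K: "0 < K" "\<And>x. x \<in> {0..1} \<Longrightarrow> \<bar>f x\<bar> \<le> K"
    by (auto simp: bounded_pos)
  have "\<bar>f x\<bar> \<le> K" for x
    using K(2)[of "frac x"] frac_lt_1[of x] periodic_frac[of f x, OF assms(1)] by simp
  with K(1) that show ?thesis by blast
qed

text \<open>The quotient map intertwines the circle map with a map of the line, so the contraction
  estimates can be made on the line.\<close>

lemma tau_shift_frac:
  assumes "\<And>x. \<psi> (x + 1) = \<psi> x"
  shows "tau_shift \<psi> L a w (frac y) = frac (a + y + L * \<psi> y + w)"
proof -
  have "tau_shift \<psi> L a w (frac y) = frac (frac y + (a + L * \<psi> y + w))"
    by (simp add: tau_shift_def tau_def periodic_frac[of \<psi>, OF assms] add_ac)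
  also have "\<dots> = frac (y + (a + L * \<psi> y + w))" by (rule frac_add_simps)
  finally show ?thesis by (simp add: add_ac)
qed

text \<open>The choice of \<open>a\<close> makes \<open>p\<close> a fixed point, so the \<open>\<delta>\<close>-neighbourhood of \<open>p\<close> is mapped into
  the \<open>\<delta>/2\<close>-neighbourhood, which leaves room for the noise.\<close>

locale contracting_lift =
  fixes \<psi> :: "real \<Rightarrow> real" and L a p \<delta> \<epsilon> :: real
  assumes eps_pos: "0 < \<epsilon>" and eps_le: "\<epsilon> \<le> \<delta> / 2"
    and periodic: "\<And>x. \<psi> (x + 1) = \<psi> x"
    and differentiable: "\<And>x. \<psi> differentiable (at x)"
    and continuous_deriv: "continuous_on UNIV (deriv \<psi>)"
    and a_eq: "a = frac (- L * \<psi> p)"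
    and contraction: "\<And>x. x \<in> {p - \<delta>..p + \<delta>} \<Longrightarrow> \<bar>tau_deriv \<psi> L x\<bar> \<le> 1 / 2"
begin

lemma DERIV_psi: "(\<psi> has_real_derivative deriv \<psi> x) (at x)"
  using differentiable[of x]
  by (simp add: DERIV_deriv_iff_real_differentiable)

lemma continuous_psi: "continuous_on UNIV \<psi>"
  by (intro continuous_at_imp_continuous_on ballI differentiable_imp_continuous_within differentiable)

lemma psi_measurable [measurable]: "\<psi> \<in> borel_measurable borel"
  by (rule borel_measurable_continuous_onI[OF continuous_psi])

lemma tau_deriv_measurable [measurable]: "tau_deriv \<psi> L \<in> borel_measurable borel"
  unfolding tau_deriv_def[abs_def]
  by (intro borel_measurable_continuous_onI continuous_intros continuous_deriv)

lemma tau_deriv_frac: "tau_deriv \<psi> L (frac x) = tau_deriv \<psi> L x"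
  by (rule periodic_frac) (simp add: tau_deriv_def periodic_deriv[of \<psi>, OF periodic])

text \<open>The noise is truncated, which makes the estimates below hold for every noise sequence instead
  of almost every one.\<close>

definition lift :: "real \<Rightarrow> real \<Rightarrow> real" where
  "lift w y = y + L * (\<psi> y - \<psi> p) + max (-\<epsilon>) (min \<epsilon> w)"

lemma frac_lift: "frac (lift w y) = tau_shift \<psi> L a (max (-\<epsilon>) (min \<epsilon> w)) (frac y)"
proof -
  let ?w = "max (-\<epsilon>) (min \<epsilon> w)"
  have "tau_shift \<psi> L a ?w (frac y) = frac (frac (- L * \<psi> p) + (y + L * \<psi> y + ?w))"
    unfolding tau_shift_frac[of \<psi>, OF periodic] a_eq by (simp add: add_ac)
  also have "\<dots> = frac (lift w y)"
    unfolding frac_add_simps lift_def by (simp add: algebra_simps)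
  finally show ?thesis by simp
qed

text \<open>The noise is additive, so the lift has derivative \<open>tau_deriv \<psi> L\<close>
  whatever the noise, and the mean value inequality applies on the interval.\<close>

lemma lift_contract:
  assumes "x \<in> {p - \<delta>..p + \<delta>}" "y \<in> {p - \<delta>..p + \<delta>}"
  shows "\<bar>lift w x - lift w y\<bar> \<le> \<bar>x - y\<bar> / 2"
proof -
  have "norm (lift w x - lift w y) \<le> 1 / 2 * norm (x - y)"
  proof (rule field_differentiable_bound)
    fix z assume z: "z \<in> {p - \<delta>..p + \<delta>}"
    have "(lift w has_real_derivative tau_deriv \<psi> L z) (at z)"
      unfolding lift_def[abs_def] tau_deriv_def
      by (auto intro!: derivative_eq_intros DERIV_psi)
    then show "(lift w has_real_derivative tau_deriv \<psi> L z) (at z within {p - \<delta>..p + \<delta>})"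
      by (rule has_field_derivative_at_within)
    show "norm (tau_deriv \<psi> L z) \<le> 1 / 2" using contraction[OF z] by simp
  qed (use assms in auto)
  then show ?thesis by simp
qed

lemma lift_mem:
  assumes "y \<in> {p - \<delta>..p + \<delta>}"
  shows "lift w y \<in> {p - \<delta>..p + \<delta>}"
proof -
  have "p \<in> {p - \<delta>..p + \<delta>}" using eps_pos eps_le by auto
  from lift_contract[OF assms this, of w]
  have "\<bar>lift w y - lift w p\<bar> \<le> \<delta> / 2" using assms by (auto simp: abs_if split: if_splits)
  \<comment> \<open>The lift moves \<open>p\<close> by the truncated noise alone, which is at most
    \<epsilon> in size.\<close>
  moreover have "\<bar>lift w p - p\<bar> \<le> \<delta> / 2"
    using eps_pos eps_le unfolding lift_def by (simp add: abs_if max_def min_def)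
  ultimately show ?thesis unfolding atLeastAtMost_iff by linarith
qed

section \<open>Backward composition and its limit\<close>

text \<open>The map with noise \<open>\<omega> 1\<close> is applied last and the one with noise
  \<open>\<omega> n\<close> first. In this order a longer composition changes only the innermost
  argument, so the values converge pointwise, which forward orbits need not do.\<close>

primrec backward :: "nat \<Rightarrow> (nat \<Rightarrow> real) \<Rightarrow> real" where
  "backward 0 \<omega> = p"
| "backward (Suc n) \<omega> = lift (\<omega> 1) (backward n (shift_seq \<omega>))"

lemma backward_mem: "backward n \<omega> \<in> {p - \<delta>..p + \<delta>}"
proof (induction n arbitrary: \<omega>)
  case 0
  show ?case using eps_pos eps_le by auto
next
  case (Suc n)
  show ?case unfolding backward.simps using Suc by (rule lift_mem)
qed

text \<open>The two compositions share their \<open>n\<close> outer maps, each contracting by one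
  half, and their innermost arguments are at most \<delta> apart.\<close>

lemma backward_step: "\<bar>backward (Suc n) \<omega> - backward n \<omega>\<bar> \<le> \<delta> * (1 / 2) ^ n"
proof (induction n arbitrary: \<omega>)
  case 0
  show ?case using backward_mem[of 1 \<omega>] by (auto simp: abs_le_iff simp del: backward.simps(2))
next
  case (Suc n)
  let ?\<omega> = "shift_seq \<omega>"
  have "\<bar>backward (Suc (Suc n)) \<omega> - backward (Suc n) \<omega>\<bar> \<le> \<bar>backward (Suc n) ?\<omega> - backward n ?\<omega>\<bar> / 2"
    unfolding backward.simps(2)[of "Suc n" \<omega>] backward.simps(2)[of n \<omega>]
    by (intro lift_contract backward_mem)
  also have "\<dots> \<le> \<delta> * (1 / 2) ^ Suc n" using Suc[of ?\<omega>] by simp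
  finally show ?case .
qed

definition pullback :: "(nat \<Rightarrow> real) \<Rightarrow> real" where
  "pullback \<omega> = lim (\<lambda>n. backward n \<omega>)"

lemma backward_tendsto: "(\<lambda>n. backward n \<omega>) \<longlonglongrightarrow> pullback \<omega>"
proof -
  have "summable (\<lambda>n. \<delta> * (1 / 2) ^ n)" by (intro summable_mult summable_geometric) simp
  then have "summable (\<lambda>n. backward (Suc n) \<omega> - backward n \<omega>)"
    by (rule summable_comparison_test'[where N = 0]) (use backward_step in simp)
  then have "(\<lambda>n. \<Sum>k<n. backward (Suc k) \<omega> - backward k \<omega>) \<longlonglongrightarrow>
      (\<Sum>k. backward (Suc k) \<omega> - backward k \<omega>)" by (rule summable_LIMSEQ)
  then have "(\<lambda>n. backward n \<omega> - backward 0 \<omega>) \<longlonglongrightarrow> (\<Sum>k. backward (Suc k) \<omega> - backward k \<omega>)"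
    unfolding sum_lessThan_telescope[of "\<lambda>n. backward n \<omega>"] .
  from tendsto_add[OF this tendsto_const[of "backward 0 \<omega>"]]
  have "convergent (\<lambda>n. backward n \<omega>)" by (auto simp: convergent_def)
  then show ?thesis unfolding pullback_def by (simp add: convergent_LIMSEQ_iff)
qed

lemma pullback_mem: "pullback \<omega> \<in> {p - \<delta>..p + \<delta>}"
  using backward_mem by (intro closed_sequentially[OF _ _ backward_tendsto]) auto

text \<open>Continuity of the lift carries the recursion of \<open>backward\<close> to the limit.
  This equation is the source of stationarity.\<close>

lemma pullback_eq: "pullback \<omega> = lift (\<omega> 1) (pullback (shift_seq \<omega>))"
proof (rule LIMSEQ_unique)
  show "(\<lambda>n. backward (Suc n) \<omega>) \<longlonglongrightarrow> pullback \<omega>"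
    using backward_tendsto by (rule LIMSEQ_Suc)
  have "continuous_on UNIV (lift w)" for w
    unfolding lift_def[abs_def] by (intro continuous_intros continuous_psi)
  then have "isCont (lift w) y" for w y by (simp add: continuous_on_eq_continuous_at)
  then show "(\<lambda>n. backward (Suc n) \<omega>) \<longlonglongrightarrow> lift (\<omega> 1) (pullback (shift_seq \<omega>))"
    unfolding backward.simps by (rule isCont_tendsto_compose[OF _ backward_tendsto])
qed

lemma lift_measurable: "(\<lambda>(w, y). lift w y) \<in> borel_measurable (borel \<Otimes>\<^sub>M borel)"
  unfolding lift_def[abs_def] by measurable

lemma backward_measurable: "backward n \<in> borel_measurable (noise_seq \<epsilon>)"
proof (induction n)
  case 0
  have "backward 0 = (\<lambda>_. p)" by (rule ext) simp
  then show ?case by simp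
next
  case (Suc n)
  have "(\<lambda>\<omega>. \<omega> 1) \<in> borel_measurable (noise_seq \<epsilon>)"
    using head_noise_measurable measurable_cong_sets[OF refl sets_noise] by blast
  moreover have "(\<lambda>\<omega>. backward n (shift_seq \<omega>)) \<in> borel_measurable (noise_seq \<epsilon>)"
    by (rule measurable_compose[OF shift_noise_measurable Suc])
  ultimately have "(\<lambda>\<omega>. (\<omega> 1, backward n (shift_seq \<omega>))) \<in> measurable (noise_seq \<epsilon>) (borel \<Otimes>\<^sub>M borel)"
    by (rule measurable_Pair)
  from measurable_compose[OF this lift_measurable]
  have "(\<lambda>\<omega>. lift (\<omega> 1) (backward n (shift_seq \<omega>))) \<in> borel_measurable (noise_seq \<epsilon>)" by simp
  moreover have "backward (Suc n) = (\<lambda>\<omega>. lift (\<omega> 1) (backward n (shift_seq \<omega>)))"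
    by (rule ext) simp
  ultimately show ?case by simp
qed

lemma pullback_measurable [measurable]: "pullback \<in> borel_measurable (noise_seq \<epsilon>)"
  using backward_tendsto by (intro borel_measurable_LIMSEQ_real[OF _ backward_measurable])

section \<open>Invariance of the law of the limit point\<close>

definition stationary :: "real measure" where
  "stationary = distr (noise_seq \<epsilon>) circle_borel (\<lambda>\<omega>. frac (pullback \<omega>))"

lemma sets_stationary [simp, measurable_cong]: "sets stationary = sets circle_borel"
  by (simp add: stationary_def)

lemma space_stationary [simp]: "space stationary = {0..<1}"
  by (simp add: stationary_def space_circle_borel)

lemma frac_pullback_measurable:
  "(\<lambda>\<omega>. frac (pullback \<omega>)) \<in> measurable (noise_seq \<epsilon>) circle_borel"
  by (rule measurable_compose[OF pullback_measurable frac_measurable])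

lemma prob_space_noise_seq: "prob_space (noise_seq \<epsilon>)"
  unfolding noise_seq_def using prob_space_noise[OF eps_pos] by (intro prob_space_PiM)

lemma prob_space_stationary: "prob_space stationary"
  unfolding stationary_def
  using prob_space_noise_seq frac_pullback_measurable by (rule prob_space.prob_space_distr)

lemma tau_shift_measurable:
  "(\<lambda>(w, x). tau_shift \<psi> L a w x) \<in> measurable (noise \<epsilon> \<Otimes>\<^sub>M stationary) stationary"
proof -
  have [measurable]: "(\<lambda>x. x) \<in> borel_measurable circle_borel" "\<psi> \<in> borel_measurable circle_borel"
    by (intro circle_borel_measurable; measurable)+
  have "(\<lambda>(w, x). a + x + L * \<psi> x + w) \<in> borel_measurable (noise \<epsilon> \<Otimes>\<^sub>M circle_borel)"
    by measurable
  from measurable_compose[OF this frac_measurable]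
  have "(\<lambda>(w, x). tau_shift \<psi> L a w x) \<in> measurable (noise \<epsilon> \<Otimes>\<^sub>M circle_borel) circle_borel"
    by (simp add: split_beta' tau_shift_def tau_def)
  then show ?thesis by (simp cong: measurable_cong_sets)
qed

text \<open>By \<open>pullback_eq\<close>, the limit point is the image, under the map with noise
  \<open>\<omega> 1\<close>, of the limit point of the shifted sequence. The latter is independent
  of \<open>\<omega> 1\<close> and has the same law.\<close>

lemma stationary_invariant: "invariant_measure \<psi> L a \<epsilon> stationary"
proof -
  interpret S: prob_space "noise_seq \<epsilon>" by (rule prob_space_noise_seq)
  have "emeasure stationary B =
      (\<integral>\<^sup>+ w. emeasure stationary (tau_shift \<psi> L a w -` B \<inter> {0..<1}) \<partial>noise \<epsilon>)"
    if B: "B \<in> sets circle_borel" for B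
  proof -
    let ?S = "noise_seq \<epsilon>" and ?f = "\<lambda>(w, \<omega>). frac (lift w (pullback \<omega>))"
    let ?g = "\<lambda>\<omega>. (\<omega> (1::nat), shift_seq \<omega>)"
    have "(\<lambda>(w, \<omega>). lift w (pullback \<omega>)) \<in> borel_measurable (noise \<epsilon> \<Otimes>\<^sub>M ?S)"
      unfolding lift_def by measurable
    from measurable_compose[OF this frac_measurable]
    have f: "?f \<in> measurable (noise \<epsilon> \<Otimes>\<^sub>M ?S) circle_borel" by (simp add: split_beta')
    have g: "?g \<in> measurable ?S (noise \<epsilon> \<Otimes>\<^sub>M ?S)"
      by (intro measurable_Pair head_noise_measurable shift_noise_measurable)
    have Q: "?f -` B \<inter> space (noise \<epsilon> \<Otimes>\<^sub>M ?S) \<in> sets (noise \<epsilon> \<Otimes>\<^sub>M ?S)"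
      using f B by (rule measurable_sets)
    have "stationary = distr ?S circle_borel (?f \<circ> ?g)"
      unfolding stationary_def by (subst pullback_eq) (simp add: comp_def)
    also have "\<dots> = distr (distr ?S (noise \<epsilon> \<Otimes>\<^sub>M ?S) ?g) circle_borel ?f"
      by (rule distr_distr[OF f g, symmetric])
    also have "distr ?S (noise \<epsilon> \<Otimes>\<^sub>M ?S) ?g = noise \<epsilon> \<Otimes>\<^sub>M ?S"
      unfolding noise_seq_def by (rule distr_head_shift[OF prob_space_noise[OF eps_pos]])
    finally have "emeasure stationary B = emeasure (distr (noise \<epsilon> \<Otimes>\<^sub>M ?S) circle_borel ?f) B"
      by simp
    also have "\<dots> = emeasure (noise \<epsilon> \<Otimes>\<^sub>M ?S) (?f -` B \<inter> space (noise \<epsilon> \<Otimes>\<^sub>M ?S))"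
      using f B by (rule emeasure_distr)
    also have "\<dots> = (\<integral>\<^sup>+ w. emeasure ?S (Pair w -` (?f -` B \<inter> space (noise \<epsilon> \<Otimes>\<^sub>M ?S))) \<partial>noise \<epsilon>)"
      by (rule S.emeasure_pair_measure_alt[OF Q])
    also have "\<dots> = (\<integral>\<^sup>+ w. emeasure stationary (tau_shift \<psi> L a w -` B \<inter> {0..<1}) \<partial>noise \<epsilon>)"
    proof (rule nn_integral_cong_AE, use AE_noise in eventually_elim)
      fix w assume "w \<in> {-\<epsilon>..\<epsilon>}"
      \<comment> \<open>For almost every noise value the truncation in \<open>lift\<close> has no
        effect, so \<open>lift\<close> induces the true circle map.\<close>
      then have w: "max (-\<epsilon>) (min \<epsilon> w) = w" by auto
      have "(\<lambda>(w, x). tau_shift \<psi> L a w x) \<circ> Pair w \<in> measurable stationary stationary"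
        by (rule measurable_comp[OF measurable_Pair1' tau_shift_measurable]) simp
      then have "tau_shift \<psi> L a w -` B \<inter> space stationary \<in> sets stationary"
        using B measurable_sets[of "tau_shift \<psi> L a w" stationary stationary B]
        by (simp add: comp_def)
      then have "emeasure stationary (tau_shift \<psi> L a w -` B \<inter> {0..<1}) =
          emeasure ?S ((\<lambda>\<omega>. frac (pullback \<omega>)) -` (tau_shift \<psi> L a w -` B \<inter> {0..<1}) \<inter> space ?S)"
        unfolding stationary_def
        by (intro emeasure_distr frac_pullback_measurable) (simp add: space_circle_borel)
      also have "(\<lambda>\<omega>. frac (pullback \<omega>)) -` (tau_shift \<psi> L a w -` B \<inter> {0..<1}) \<inter> space ?S =
          Pair w -` (?f -` B \<inter> space (noise \<epsilon> \<Otimes>\<^sub>M ?S))"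
        by (auto simp: space_pair_measure frac_lift w frac_lt_1)
      finally show "emeasure ?S (Pair w -` (?f -` B \<inter> space (noise \<epsilon> \<Otimes>\<^sub>M ?S))) =
          emeasure stationary (tau_shift \<psi> L a w -` B \<inter> {0..<1})" by simp
    qed
    finally show ?thesis .
  qed
  then show ?thesis
    unfolding invariant_measure_def using prob_space_stationary by simp
qed

text \<open>The limit point never leaves the interval of contraction, and periodicity of the
  derivative carries the bound to the circle.\<close>

lemma AE_stationary_contraction: "AE x in stationary. \<bar>tau_deriv \<psi> L x\<bar> \<le> 1 / 2"
proof -
  have [measurable]: "tau_deriv \<psi> L \<in> borel_measurable circle_borel"
    by (rule circle_borel_measurable) measurable
  have "{x \<in> space circle_borel. \<bar>tau_deriv \<psi> L x\<bar> \<le> 1 / 2} \<in> sets circle_borel" by measurable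
  then show ?thesis
    unfolding stationary_def using contraction[OF pullback_mem]
    by (subst AE_distr_iff[OF frac_pullback_measurable]) (auto simp: tau_deriv_frac)
qed

end

section \<open>Existence and sign of the Lyapunov exponent\<close>

lemma skew_product_orbit:
  fixes \<psi> L a defines "T \<equiv> (\<lambda>(\<omega>, x). (shift_seq \<omega>, tau_shift \<psi> L a (\<omega> 1) x))"
  shows "snd ((T ^^ k) (\<omega>, x)) = orbit \<psi> L a \<omega> x k"
proof -
  \<comment> \<open>The induction must also track the shifted noise, and only at indices from
    \<open>1\<close> on, where \<open>shift_seq\<close> is the true shift.\<close>
  have "(\<forall>n\<ge>1. fst ((T ^^ k) (\<omega>, x)) n = \<omega> (n + k)) \<and> snd ((T ^^ k) (\<omega>, x)) = orbit \<psi> L a \<omega> x k"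
  proof (induction k)
    case (Suc k)
    then show ?case by (simp add: T_def split_beta shift_seq_apply)
  qed simp
  then show ?thesis ..
qed

text \<open>In \<open>ereal\<close> the value \<open>\<infinity>\<close> absorbs
  \<open>-\<infinity>\<close>, hence the condition that no summand is
  \<open>\<infinity>\<close>.\<close>

lemma sum_ereal_MInfty:
  fixes f :: "'a \<Rightarrow> ereal"
  assumes "finite A" "i \<in> A" "f i = -\<infinity>" "\<And>j. j \<in> A \<Longrightarrow> f j \<noteq> \<infinity>"
  shows "sum f A = -\<infinity>"
proof -
  have "sum f (A - {i}) \<noteq> \<infinity>" using assms by (simp add: sum_Pinfty)
  then show ?thesis using assms by (simp add: sum.remove)
qed

text \<open>\<open>ln 0 = 0\<close> hides zeros of the derivative from the real-valued averages; an orbit that meets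
  such a zero has exponent \<open>-\<infinity>\<close> directly.\<close>

lemma lyapunov_negative:
  assumes contr: "\<And>k. \<bar>tau_deriv \<psi> L (orbit \<psi> L a \<omega> x k)\<bar> \<le> 1 / 2"
    and conv: "convergent (\<lambda>n. ereal
      ((\<Sum>k<n. max 0 (- ln \<bar>tau_deriv \<psi> L (orbit \<psi> L a \<omega> x k)\<bar>)) / real n))"
  shows "convergent (lyapunov_average \<psi> L a \<omega> x) \<and> lyapunov \<psi> L a \<omega> x < 0"
proof -
  define d where "d k = tau_deriv \<psi> L (orbit \<psi> L a \<omega> x k)" for k
  have avg: "lyapunov_average \<psi> L a \<omega> x n = (\<Sum>k<n. log_abs (d k)) / ereal (real n)" for n
    by (simp add: lyapunov_average_def d_def)
  have "\<exists>l<0. lyapunov_average \<psi> L a \<omega> x \<longlonglongrightarrow> l"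
  proof (cases "\<exists>k. d k = 0")
    case True
    then obtain k where k: "d k = 0" by blast
    \<comment> \<open>From \<open>Suc k\<close> on, the sum contains the term of index
      \<open>k\<close> and the denominator is positive.\<close>
    have "lyapunov_average \<psi> L a \<omega> x n = -\<infinity>" if "n \<ge> Suc k" for n
    proof -
      have "(\<Sum>k<n. log_abs (d k)) = -\<infinity>"
        using that k by (intro sum_ereal_MInfty[of _ k]) (auto simp: log_abs_def)
      then show ?thesis using that by (simp add: avg)
    qed
    then have "lyapunov_average \<psi> L a \<omega> x \<longlonglongrightarrow> -\<infinity>"
      by (intro tendsto_eventually) (auto simp: eventually_sequentially)
    then show ?thesis by (intro exI[of _ "-\<infinity>"]) simp
  next
    case False
    let ?A = "\<lambda>n. ereal ((\<Sum>k<n. max 0 (- ln \<bar>d k\<bar>)) / real n)"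
    have ln_d: "ln 2 \<le> - ln \<bar>d k\<bar>" for k
    proof -
      have "ln \<bar>d k\<bar> \<le> ln (1 / 2)" using contr[of k] False by (subst ln_le_cancel_iff) (auto simp: d_def)
      then show ?thesis by (simp add: ln_div)
    qed
    have ln2: "0 < ln (2 :: real)" by simp
    \<comment> \<open>The maximum with \<open>0\<close> makes the Birkhoff integrand nonnegative
      everywhere; along a contracted orbit it changes nothing.\<close>
    have max_d: "max 0 (- ln \<bar>d k\<bar>) = - ln \<bar>d k\<bar>" for k using ln_d[of k] ln2 by linarith
    obtain l where l: "?A \<longlonglongrightarrow> l" using conv by (auto simp: convergent_def d_def)
    have "ereal (ln 2) \<le> ?A n" if "n \<ge> 1" for n
    proof -
      have "(\<Sum>k<n. ln (2::real)) \<le> (\<Sum>k<n. max 0 (- ln \<bar>d k\<bar>))"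
        using ln_d by (intro sum_mono) (simp only: max_d)
      then show ?thesis using that by (simp add: field_simps)
    qed
    then have "ereal (ln 2) \<le> l" by (intro LIMSEQ_le_const[OF l]) auto
    moreover have "0 < ereal (ln 2)" using ln2 by simp
    ultimately have "0 < l" by (rule less_le_trans[rotated])
    have "lyapunov_average \<psi> L a \<omega> x n = - ?A n" if "n \<ge> 1" for n
      using that False by (simp add: avg log_abs_def max_d sum_negf)
    then have "\<forall>\<^sub>F n in sequentially. - ?A n = lyapunov_average \<psi> L a \<omega> x n"
      unfolding eventually_sequentially by metis
    from Lim_transform_eventually[OF tendsto_uminus_ereal[OF l] this]
    have "lyapunov_average \<psi> L a \<omega> x \<longlonglongrightarrow> - l" .
    moreover have "- l < 0" using \<open>0 < l\<close> by (cases l) auto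
    ultimately show ?thesis by blast
  qed
  then show ?thesis by (auto simp: lyapunov_def convergent_def dest: limI)
qed

text \<open>Birkhoff's theorem for the skew product supplies convergence of the averages, the
  contraction bound on the support of the measure supplies the sign, and
  \<open>lyapunov_negative\<close> combines them orbit by orbit.\<close>

lemma (in contracting_lift) AE_lyapunov_negative:
  "AE (\<omega>, x) in noise_seq \<epsilon> \<Otimes>\<^sub>M stationary.
     convergent (lyapunov_average \<psi> L a \<omega> x) \<and> lyapunov \<psi> L a \<omega> x < 0"
proof -
  let ?T = "\<lambda>(\<omega>, x). (shift_seq \<omega>, tau_shift \<psi> L a (\<omega> 1) x)"
  let ?M = "noise_seq \<epsilon> \<Otimes>\<^sub>M stationary"
  let ?f = "\<lambda>z. max 0 (- ln \<bar>tau_deriv \<psi> L (snd z)\<bar>)"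
  interpret measure_preserving ?M ?T
    unfolding noise_seq_def
    using stationary_invariant
    by (intro skew_product_measure_preserving prob_space_noise eps_pos prob_space_stationary
        tau_shift_measurable) (auto simp: invariant_measure_def)
  have tau_deriv_stationary [measurable]: "tau_deriv \<psi> L \<in> borel_measurable stationary"
    using circle_borel_measurable[OF tau_deriv_measurable] by (simp cong: measurable_cong_sets)
  have "AE z in ?M. convergent (\<lambda>n. ereal (birkhoff_sum ?T ?f n z / real n))"
    by (rule birkhoff_nonneg) auto
  moreover have "AE z in ?M. \<bar>tau_deriv \<psi> L (snd z)\<bar> \<le> 1 / 2"
  proof -
    interpret S: prob_space "noise_seq \<epsilon>" by (rule prob_space_noise_seq)
    interpret \<mu>: prob_space stationary by (rule prob_space_stationary)
    interpret P: pair_prob_space "noise_seq \<epsilon>" stationary ..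
    have [measurable]: "(\<lambda>z. tau_deriv \<psi> L (snd z)) \<in> borel_measurable ?M"
      by (rule measurable_compose[OF measurable_snd tau_deriv_stationary])
    have "{z \<in> space ?M. \<bar>tau_deriv \<psi> L (snd z)\<bar> \<le> 1 / 2} \<in> sets ?M" by measurable
    then show ?thesis
      by (rule P.AE_pair_measure) (simp only: snd_conv AE_stationary_contraction AE_I2)
  qed
  \<comment> \<open>Invariance of the product measure extends the bound from the initial point to
    the whole orbit.\<close>
  then have "AE z in ?M. \<forall>k. \<bar>tau_deriv \<psi> L (snd ((?T ^^ k) z))\<bar> \<le> 1 / 2" by (rule AE_funpow)
  ultimately show ?thesis
  proof eventually_elim
    case (elim z)
    obtain \<omega> x where z: "z = (\<omega>, x)" by (cases z)
    show ?case
      using elim unfolding z birkhoff_sum_def skew_product_orbit prod.case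
      by (intro lyapunov_negative) auto
  qed
qed

section \<open>Choice of the constants and of the zero of the derivative\<close>

theorem proposition4:
  fixes \<psi> :: "real \<Rightarrow> real" and N :: nat
  assumes "circle_C2 \<psi>"
    and "0 < N"
    and "finite (circle_crit \<psi>)"
    and "card (circle_crit \<psi>) = N"
    and "\<forall>c \<in> circle_crit \<psi>. deriv (deriv \<psi>) c \<noteq> 0"
  shows "\<exists>D::real. 0 < D \<and> (\<exists>L\<^sub>0::real. 0 < L\<^sub>0 \<and>
    (\<forall>L::real. L\<^sub>0 \<le> L \<longrightarrow> (\<forall>\<epsilon>::real. 0 < \<epsilon> \<and> \<epsilon> \<le> D * inverse L \<longrightarrow>
      (\<exists>a \<in> {0..<1}. \<exists>\<mu>. invariant_measure \<psi> L a \<epsilon> \<mu> \<and>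
        (AE (\<omega>, x) in noise_seq \<epsilon> \<Otimes>\<^sub>M \<mu>.
          convergent (lyapunov_average \<psi> L a \<omega> x) \<and> lyapunov \<psi> L a \<omega> x < 0)))))"
proof -
  have periodic: "\<psi> (x + 1) = \<psi> x" for x using assms(1) by (simp add: circle_C2_def)
  have diff: "\<psi> differentiable (at x)" for x using assms(1) by (simp add: circle_C2_def)
  have DERIV2: "(deriv \<psi> has_real_derivative deriv (deriv \<psi>) x) (at x)" for x
    using assms(1) by (simp add: circle_C2_def DERIV_deriv_iff_real_differentiable)
  have cont1: "continuous_on UNIV (deriv \<psi>)"
    using DERIV2 by (blast intro: DERIV_continuous_on has_field_derivative_at_within)
  obtain K where K: "0 < K" "\<And>x. \<bar>deriv (deriv \<psi>) x\<bar> \<le> K"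
  proof -
    have "deriv (deriv \<psi>) (x + 1) = deriv (deriv \<psi>) x" for x
      by (intro periodic_deriv periodic)
    moreover have "continuous_on UNIV (deriv (deriv \<psi>))"
      using assms(1) by (simp add: circle_C2_def)
    ultimately show ?thesis using that periodic_continuous_bounded by blast
  qed
  have lipschitz: "\<bar>deriv \<psi> x - deriv \<psi> y\<bar> \<le> K * \<bar>x - y\<bar>" for x y
    using field_differentiable_bound[of UNIV "deriv \<psi>" "deriv (deriv \<psi>)" K x y] DERIV2 K(2) by simp
  have "circle_crit \<psi> \<noteq> {}" using assms(2,4) by auto
  then obtain c where c: "deriv \<psi> c = 0" "deriv (deriv \<psi>) c \<noteq> 0"
    using assms(5) by (auto simp: circle_crit_def)
  \<comment> \<open>At a nondegenerate critical point the derivative changes sign, so it is negative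
    on one side; the sign of the second derivative tells which.\<close>
  obtain q where q: "deriv \<psi> q < 0"
  proof (cases "deriv (deriv \<psi>) c < 0")
    case True
    obtain d where "0 < d" "\<forall>h>0. h < d \<longrightarrow> deriv \<psi> (c + h) < deriv \<psi> c"
      using DERIV_neg_dec_right[OF DERIV2 True] by blast
    with c(1) that[of "c + d / 2"] show ?thesis by simp
  next
    case False
    with c(2) have "0 < deriv (deriv \<psi>) c" by simp
    from DERIV_pos_inc_left[OF DERIV2 this]
    obtain d where "0 < d" "\<forall>h>0. h < d \<longrightarrow> deriv \<psi> (c - h) < deriv \<psi> c" by blast
    with c(1) that[of "c - d / 2"] show ?thesis by simp
  qed
  \<comment> \<open>\<open>?D * inverse L\<close> is half the radius \<delta> chosen below, and
    \<open>?L0\<close> is the value of \<open>L\<close> from which \<open>- 1 / L\<close> is at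
    least \<open>deriv \<psi> q\<close>.\<close>
  let ?D = "1 / (4 * K)" and ?L0 = "1 / (- deriv \<psi> q)"
  have "\<exists>a\<in>{0..<1}. \<exists>\<mu>. invariant_measure \<psi> L a \<epsilon> \<mu> \<and>
      (AE (\<omega>, x) in noise_seq \<epsilon> \<Otimes>\<^sub>M \<mu>.
        convergent (lyapunov_average \<psi> L a \<omega> x) \<and> lyapunov \<psi> L a \<omega> x < 0)"
    if L: "?L0 \<le> L" and eps: "0 < \<epsilon>" "\<epsilon> \<le> ?D * inverse L" for L \<epsilon>
  proof -
    have "0 < ?L0" using q by simp
    with L have L_pos: "0 < L" by linarith
    \<comment> \<open>The value \<open>- 1 / L\<close>, at which \<open>tau_deriv\<close> vanishes,
      lies between the derivatives at \<open>q\<close> and \<open>c\<close>, so the intermediate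
      value theorem yields \<open>p\<close>.\<close>
    have "deriv \<psi> q \<le> - 1 / L" using L L_pos q by (simp add: field_simps)
    moreover have "- 1 / L \<le> deriv \<psi> c" using c(1) L_pos by simp
    moreover have "connected (range (deriv \<psi>))"
      using cont1 by (intro connected_continuous_image) auto
    ultimately have "- 1 / L \<in> range (deriv \<psi>)" by (meson connectedD_interval rangeI)
    then obtain p where p: "deriv \<psi> p = - 1 / L" by (metis imageE)
    \<comment> \<open>The radius solves \<open>L * (K * \<delta>) = 1 / 2\<close>, where
      \<open>L * K\<close> is a Lipschitz constant of \<open>tau_deriv \<psi> L\<close>.\<close>
    define \<delta> where "\<delta> = 1 / (2 * K * L)"
    define a where "a = frac (- L * \<psi> p)"
    interpret contracting_lift \<psi> L a p \<delta> \<epsilon>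
    proof
      show "\<epsilon> \<le> \<delta> / 2" using eps(2) K(1) L_pos by (simp add: \<delta>_def field_simps)
      fix x assume x: "x \<in> {p - \<delta>..p + \<delta>}"
      have "tau_deriv \<psi> L x = L * (deriv \<psi> x - deriv \<psi> p)"
        using L_pos by (simp add: tau_deriv_def p field_simps)
      then have "\<bar>tau_deriv \<psi> L x\<bar> \<le> L * (K * \<bar>x - p\<bar>)"
        using lipschitz[of x p] L_pos by (simp add: abs_mult)
      also have "\<dots> \<le> L * (K * \<delta>)" using x L_pos K(1) by (intro mult_left_mono) auto
      also have "\<dots> = 1 / 2" using L_pos K(1) by (simp add: \<delta>_def)
      finally show "\<bar>tau_deriv \<psi> L x\<bar> \<le> 1 / 2" .
    qed (fact eps periodic diff cont1 a_def)+
    have "a \<in> {0..<1}" by (simp add: a_def frac_lt_1)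
    then show ?thesis using stationary_invariant AE_lyapunov_negative by blast
  qed
  moreover have "0 < ?D" "0 < ?L0" using K(1) q by auto
  ultimately show ?thesis by blast
qed

end
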